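(* Let $G$ be the non-weighted complete bipartite graph with components $S$ and $S^c$, where $|S|=N$, $|S^c|=M$ and $N>M$. Let $\lambda_0\le\lambda_1\le\dots\le\lambda_{N+M-1}$ be the eigenvalues of $\Delta$ and $e_0,\dots,e_{N+M-1}$ corresponding orthonormal eigenfunctions, $\Delta e_j=\lambda_je_j$. For this graph and this set $S$, all of the following statements, which are asserted for every subset $S$ of vertices of a finite graph with vertex set $V$ (where $\Lambda_S$ denotes the Poincaré constant of $S^c$), are sharp: (i) $\Lambda_S\ge K_S$; (ii) $S$ is a uniqueness set for every space $PW_\omega(G)$ with $\omega<\Lambda_S$; (iii) $\mathcal{N}[0,\Lambda_S)\le|S|$; (iv) $\mathcal{N}[\Lambda_S,\lambda_{|V|-1}]\ge|S^c|$; (v) $\lambda_{|S|}\ge\Lambda_S$. Namely, for the complete bipartite graph we have: 1) the Poincaré constant $\Lambda_S$ of $S^c$ satisfies $\Lambda_S=K_S=|S|=N$; 2) the set $S$ is the uniqueness set for the span of the first $N$ eigenfunctions $e_0,\dots,e_{N-1}$; 3) $\mathcal{N}[0,N)=N$; 4) $\mathcal{N}[N,\lambda_{N+M-1}]=M$; 5) $\lambda_N=N$.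
   Context: The non-weighted complete bipartite graph has vertex set $V(G)=S\sqcup S^c$; every vertex in one component is connected to every vertex in the other, there are no edges inside the components, and every edge has weight one. For a finite graph with edge weights $w(u,v)$, the degree $\mu(v)$ is the sum of the weights of the edges incident to $v$; $L_2(G)$ is the space of complex-valued functions on $V(G)$ with inner product $\langle f,g\rangle=\sum_{v\in V(G)}f(v)\overline{g(v)}\,\mu(v)$; and $(\Delta f)(v)=\sum_{u\in V(G)}(f(v)-f(u))w(v,u)$, regarded as a positive-semidefinite self-adjoint operator. The Poincaré constant of a set $U\subset V(G)$ is the best (largest) $\Lambda>0$ such that $\|\varphi\|\le\Lambda^{-1}\|\Delta\varphi\|$ for all $\varphi\in L_2(G)$ vanishing outside $U$. $K_S=\inf_{v\in S^c}\sum_{s\in S}w(s,v)$. $\mathcal{N}I$ denotes the number of eigenvalues of $\Delta$ (with multiplicity) in an interval $I$. $PW_\omega(G)$ is the span of the eigenfunctions of $\Delta$ with eigenvalues not greater than $\omega$. $S$ is a uniqueness set for a space of functions on $V(G)$ if every function in the space is completely determined by its values on $S$.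
   Formalization: The e_j are orthonormal for the unweighted inner product (no degree-weighted orthonormal eigenbasis exists); Λ_S=N, λ_N=N and sharpness are claimed for M≥2 only, since for M=1 (star) λ_N=N+1 and Λ_S=√(N²+1); M≥1 is assumed. *)

theory Defs
  imports "HOL-Analysis.Analysis"
begin

text \<open>
  The vertex set is a finite type and the edge weights are a symmetric function
  \<open>w :: 'v \<Rightarrow> 'v \<Rightarrow> real\<close> (weight 0 means no edge). Functions on the vertices are elements of
  \<open>complex ^ 'v\<close>; the linear algebra over the complex field is that of the locale \<open>vec\<close>.
\<close>

definition vertex_degree :: "('v::finite \<Rightarrow> 'v \<Rightarrow> real) \<Rightarrow> 'v \<Rightarrow> real" where
  "vertex_degree w v = (\<Sum>u\<in>UNIV. w v u)"

text \<open>
  The inner product carries an arbitrary vertex measure \<open>m\<close>, because two of them matter: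
  \<open>m = vertex_degree w\<close> is the inner product of \<open>L\<^sub>2(G)\<close>, while the unnormalized Laplacian below is
  self-adjoint for the counting measure \<open>m = (\<lambda>_. 1)\<close> and in general not for \<open>vertex_degree w\<close>.
  Indeed, a complete bipartite graph with parts of different sizes has no basis of eigenfunctions
  that is orthogonal for \<open>vertex_degree w\<close>.
\<close>

definition l2_inner :: "('v::finite \<Rightarrow> real) \<Rightarrow> complex ^ 'v \<Rightarrow> complex ^ 'v \<Rightarrow> complex" where
  "l2_inner m f g = (\<Sum>v\<in>UNIV. f $ v * cnj (g $ v) * of_real (m v))"

definition l2_norm :: "('v::finite \<Rightarrow> real) \<Rightarrow> complex ^ 'v \<Rightarrow> real" where
  "l2_norm m f = sqrt (Re (l2_inner m f f))"

definition orthonormal_family ::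
    "('v::finite \<Rightarrow> real) \<Rightarrow> 'i set \<Rightarrow> ('i \<Rightarrow> complex ^ 'v) \<Rightarrow> bool" where
  "orthonormal_family m I e \<longleftrightarrow>
     (\<forall>i\<in>I. \<forall>j\<in>I. l2_inner m (e i) (e j) = (if i = j then 1 else 0))"

definition laplacian :: "('v::finite \<Rightarrow> 'v \<Rightarrow> real) \<Rightarrow> complex ^ 'v \<Rightarrow> complex ^ 'v" where
  "laplacian w f = (\<chi> v. \<Sum>u\<in>UNIV. (f $ v - f $ u) * of_real (w v u))"

lemma laplacian_self_adjoint:
  assumes "\<And>u v. w u v = w v u"
  shows "l2_inner (\<lambda>_. 1) (laplacian w f) g = l2_inner (\<lambda>_. 1) f (laplacian w g)"
proof -
  have "(\<Sum>v\<in>UNIV. \<Sum>u\<in>UNIV. f $ u * of_real (w v u) * cnj (g $ v)) =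
        (\<Sum>v\<in>UNIV. \<Sum>u\<in>UNIV. f $ v * of_real (w v u) * cnj (g $ u))"
    by (subst sum.swap) (simp add: assms)
  then show ?thesis
    by (simp add: l2_inner_def laplacian_def sum_distrib_left sum_distrib_right
        algebra_simps sum_subtractf)
qed

definition eigenspace :: "('v::finite \<Rightarrow> 'v \<Rightarrow> real) \<Rightarrow> real \<Rightarrow> (complex ^ 'v) set" where
  "eigenspace w t = {f. laplacian w f = of_real t *s f}"

definition eigenvalues :: "('v::finite \<Rightarrow> 'v \<Rightarrow> real) \<Rightarrow> real set" where
  "eigenvalues w = {t. \<exists>f. f \<noteq> 0 \<and> laplacian w f = of_real t *s f}"

definition eigenvalue_count :: "('v::finite \<Rightarrow> 'v \<Rightarrow> real) \<Rightarrow> real set \<Rightarrow> nat" where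
  "eigenvalue_count w I = (\<Sum>t\<in>eigenvalues w \<inter> I. vec.dim (eigenspace w t))"

definition PW :: "('v::finite \<Rightarrow> 'v \<Rightarrow> real) \<Rightarrow> real \<Rightarrow> (complex ^ 'v) set" where
  "PW w \<omega> = vec.span (\<Union>t\<in>{..\<omega>}. eigenspace w t)"

definition poincare_constant ::
    "('v::finite \<Rightarrow> real) \<Rightarrow> ('v \<Rightarrow> 'v \<Rightarrow> real) \<Rightarrow> 'v set \<Rightarrow> real" where
  "poincare_constant m w U = (GREATEST \<Lambda>. \<Lambda> > 0 \<and>
     (\<forall>\<phi>. (\<forall>v. v \<notin> U \<longrightarrow> \<phi> $ v = 0) \<longrightarrow> l2_norm m \<phi> \<le> inverse \<Lambda> * l2_norm m (laplacian w \<phi>)))"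

definition K_const :: "('v::finite \<Rightarrow> 'v \<Rightarrow> real) \<Rightarrow> 'v set \<Rightarrow> real" where
  "K_const w S = (INF v\<in>- S. \<Sum>s\<in>S. w s v)"

definition uniqueness_set :: "'v::finite set \<Rightarrow> (complex ^ 'v) set \<Rightarrow> bool" where
  "uniqueness_set S X \<longleftrightarrow> (\<forall>f\<in>X. \<forall>g\<in>X. (\<forall>s\<in>S. f $ s = g $ s) \<longrightarrow> f = g)"

definition complete_bipartite :: "'v set \<Rightarrow> 'v \<Rightarrow> 'v \<Rightarrow> real" where
  "complete_bipartite S u v = (if (u \<in> S) \<noteq> (v \<in> S) then 1 else 0)"

end

(* Write n = |S| > |S^c|. An eigenfunction f with eigenvalue t < n satisfies n f(v) = sum of f over S
   for v outside S, and one with t >= n satisfies n f(s) = - (sum of f over S^c) for s in S. Both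
   conditions are linear, so S is a uniqueness set for the span of the eigenfunctions of the first
   kind and S^c for the span of those of the second kind. Hence an eigenbasis has at most |S|
   members of the first and at most |S^c| of the second kind, and since there are |S| + |S^c| in
   total both bounds are equalities; no eigenspace has to be computed. If |S^c| >= 2, the
   difference of two point masses in S^c is an eigenfunction for n, which gives sharpness. On
   functions f vanishing on S, Laplace f = n f on S^c, which gives the Poincare inequality for
   every vertex measure. *)

theory Submission
  imports Defs
begin

section \<open>Weighted inner products and orthonormal families\<close>

lemma l2_inner_add_left: "l2_inner m (f + g) h = l2_inner m f h + l2_inner m g h"
  by (simp add: l2_inner_def sum.distrib algebra_simps)

lemma l2_inner_scale_left: "l2_inner m (c *s f) h = c * l2_inner m f h"
  by (simp add: l2_inner_def sum_distrib_left algebra_simps)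

lemma l2_inner_scale_right: "l2_inner m f (c *s h) = cnj c * l2_inner m f h"
  by (simp add: l2_inner_def sum_distrib_left algebra_simps)

lemma l2_inner_sum_left:
  "l2_inner m (\<Sum>i\<in>I. c i *s f i) h = (\<Sum>i\<in>I. c i * l2_inner m (f i) h)"
proof (induction I rule: infinite_finite_induct)
  case (insert i I)
  then show ?case
    by (simp add: l2_inner_add_left l2_inner_scale_left)
qed (simp_all add: l2_inner_def)

lemma orthonormal_coefficient:
  assumes "orthonormal_family m I e" "finite I" "i \<in> I"
  shows "l2_inner m (\<Sum>j\<in>I. c j *s e j) (e i) = c i"
proof -
  have "l2_inner m (\<Sum>j\<in>I. c j *s e j) (e i) = (\<Sum>j\<in>I. if j = i then c j else 0)"
    unfolding l2_inner_sum_left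
    using assms by (intro sum.cong) (auto simp: orthonormal_family_def)
  also have "\<dots> = c i"
    using assms by simp
  finally show ?thesis .
qed

lemma orthonormal_inj_on:
  assumes "orthonormal_family m I e"
  shows "inj_on e I"
proof (rule inj_onI)
  fix i j assume "i \<in> I" "j \<in> I" "e i = e j"
  then show "i = j"
    using assms unfolding orthonormal_family_def by (metis zero_neq_one)
qed

text \<open>Pairing a vanishing combination with \<open>e i\<close> isolates its
  coefficient.\<close>

lemma orthonormal_independent:
  assumes "orthonormal_family m I e" "finite I"
  shows "vec.independent (e ` I)"
proof (rule vec.independent_if_scalars_zero)
  fix c x assume sum0: "(\<Sum>x\<in>e ` I. c x *s x) = 0" and "x \<in> e ` I"
  then obtain i where i: "i \<in> I" "x = e i"
    by blast
  have "(\<Sum>j\<in>I. c (e j) *s e j) = 0"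
    using sum0 by (simp add: sum.reindex[OF orthonormal_inj_on[OF assms(1)]])
  then show "c x = 0"
    using orthonormal_coefficient[OF assms i(1), of "\<lambda>j. c (e j)"] i(2)
    by (simp add: l2_inner_def)
qed (use assms in simp)

lemma orthonormal_expansion:
  assumes "orthonormal_family m I e" "finite I" "f \<in> vec.span (e ` I)"
  shows "f = (\<Sum>i\<in>I. l2_inner m f (e i) *s e i)"
proof -
  obtain c where "f = (\<Sum>x\<in>e ` I. c x *s x)"
    using assms(2,3) vec.span_finite[of "e ` I"] by auto
  then have f: "f = (\<Sum>j\<in>I. c (e j) *s e j)"
    by (simp add: sum.reindex[OF orthonormal_inj_on[OF assms(1)]])
  have "l2_inner m f (e i) = c (e i)" if "i \<in> I" for i
    unfolding f by (rule orthonormal_coefficient[OF assms(1,2) that])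
  then show ?thesis
    by (simp add: f)
qed

lemma orthonormal_nonzero:
  assumes "orthonormal_family m I e" "i \<in> I"
  shows "e i \<noteq> 0"
proof
  assume "e i = 0"
  then have "l2_inner m (e i) (e i) = 0"
    by (simp add: l2_inner_def)
  then show False
    using assms by (simp add: orthonormal_family_def)
qed

lemma orthonormal_span_UNIV:
  fixes e :: "'i \<Rightarrow> complex ^ 'v::finite"
  assumes "orthonormal_family m I e" "card I = CARD('v)"
  shows "vec.span (e ` I) = UNIV"
proof -
  have "finite I"
    using assms(2) by (simp add: card_ge_0_finite)
  have "vec.dim (UNIV :: (complex ^ 'v) set) \<le> card (e ` I)"
    by (simp add: card_image orthonormal_inj_on[OF assms(1)] assms(2) vec_dim_card
        del: vec.dim_UNIV)
  then show ?thesis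
    using vec.card_ge_dim_independent[OF _ orthonormal_independent[OF assms(1) \<open>finite I\<close>], of UNIV]
    by auto
qed

section \<open>Linearity of the Laplacian\<close>

lemma laplacian_zero: "laplacian w 0 = 0"
  by (simp add: laplacian_def vec_eq_iff)

lemma laplacian_add: "laplacian w (f + g) = laplacian w f + laplacian w g"
  by (simp add: laplacian_def vec_eq_iff algebra_simps sum.distrib sum_subtractf)

lemma laplacian_scale: "laplacian w (c *s f) = c *s laplacian w f"
  by (simp add: laplacian_def vec_eq_iff algebra_simps sum_distrib_left sum_subtractf)

lemma subspace_eigenspace: "vec.subspace (eigenspace w t)"
  by (auto simp: vec.subspace_def eigenspace_def laplacian_zero laplacian_add laplacian_scale
      algebra_simps vec.scale_right_distrib)

section \<open>Eigenvalue counts read off an orthonormal eigenbasis\<close>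

locale orthonormal_eigenbasis =
  fixes w :: "'v::finite \<Rightarrow> 'v \<Rightarrow> real"
    and I :: "'i set" and e :: "'i \<Rightarrow> complex ^ 'v" and ev :: "'i \<Rightarrow> real"
  assumes weight_sym: "w u v = w v u"
    and orthonormal: "orthonormal_family (\<lambda>_. 1) I e"
    and card_index: "card I = CARD('v)"
    and eigenvector: "j \<in> I \<Longrightarrow> laplacian w (e j) = of_real (ev j) *s e j"
begin

lemma finite_index: "finite I"
  using card_index by (simp add: card_ge_0_finite)

text \<open>In the basis expansion of an eigenfunction for \<open>t\<close>, self-adjointness kills
  every coefficient that belongs to another eigenvalue.\<close>

lemma eigenspace_eq_span: "eigenspace w t = vec.span (e ` {j \<in> I. ev j = t})"
proof
  show "vec.span (e ` {j \<in> I. ev j = t}) \<subseteq> eigenspace w t"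
    by (rule vec.span_minimal[OF _ subspace_eigenspace]) (auto simp: eigenspace_def eigenvector)
  show "eigenspace w t \<subseteq> vec.span (e ` {j \<in> I. ev j = t})"
  proof
    fix f assume "f \<in> eigenspace w t"
    then have f: "laplacian w f = of_real t *s f"
      by (simp add: eigenspace_def)
    have orth: "l2_inner (\<lambda>_. 1) f (e j) = 0" if "j \<in> I" "ev j \<noteq> t" for j
    proof -
      \<comment> \<open>\<open>ev j\<close> is real, so it leaves the second slot of the inner
        product unconjugated.\<close>
      have "of_real t * l2_inner (\<lambda>_. 1) f (e j) = of_real (ev j) * l2_inner (\<lambda>_. 1) f (e j)"
        using laplacian_self_adjoint[of w f "e j"] that
        by (simp add: weight_sym f eigenvector l2_inner_scale_left l2_inner_scale_right)
      then show ?thesis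
        using that by simp
    qed
    have "f = (\<Sum>j\<in>I. l2_inner (\<lambda>_. 1) f (e j) *s e j)"
      using orthonormal_expansion[OF orthonormal finite_index]
        orthonormal_span_UNIV[OF orthonormal card_index] by auto
    also have "\<dots> = (\<Sum>j\<in>{j \<in> I. ev j = t}. l2_inner (\<lambda>_. 1) f (e j) *s e j)"
      using orth by (intro sum.mono_neutral_right) (auto simp: finite_index)
    also have "\<dots> \<in> vec.span (e ` {j \<in> I. ev j = t})"
      by (intro vec.span_sum vec.span_scale vec.span_base) auto
    finally show "f \<in> vec.span (e ` {j \<in> I. ev j = t})" .
  qed
qed

lemma independent_subfamily: "J \<subseteq> I \<Longrightarrow> vec.independent (e ` J)"
  using vec.independent_mono[OF orthonormal_independent[OF orthonormal finite_index]] by blast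

lemma dim_eigenspace: "vec.dim (eigenspace w t) = card {j \<in> I. ev j = t}"
proof -
  have "inj_on e {j \<in> I. ev j = t}"
    using orthonormal_inj_on[OF orthonormal] by (rule inj_on_subset) auto
  then show ?thesis
    using vec.dim_span_eq_card_independent[OF independent_subfamily, of "{j \<in> I. ev j = t}"]
    by (simp only: eigenspace_eq_span card_image Collect_restrict)
qed

lemma eigenvalues_eq: "eigenvalues w = ev ` I"
proof -
  have "t \<in> eigenvalues w" if t: "t \<in> ev ` I" for t
  proof -
    obtain j where j: "j \<in> I" "ev j = t"
      using t by blast
    then have "e j \<noteq> 0"
      using orthonormal_nonzero[OF orthonormal] by blast
    then show ?thesis
      using j eigenvector by (auto simp: eigenvalues_def)
  qed
  moreover have "t \<in> ev ` I" if t: "t \<in> eigenvalues w" for t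
  proof (rule ccontr)
    assume "t \<notin> ev ` I"
    then have empty: "{j \<in> I. ev j = t} = {}"
      by auto
    have "eigenspace w t = {0}"
      by (simp only: eigenspace_eq_span empty image_empty vec.span_empty)
    then show False
      using t by (auto simp: eigenvalues_def eigenspace_def)
  qed
  ultimately show ?thesis
    by blast
qed

text \<open>The fibres of \<open>ev\<close> are disjoint, and the fibre over \<open>t\<close> has as
  many indices as the dimension of the eigenspace. Counting with multiplicity is therefore counting
  indices.\<close>

lemma eigenvalue_count_eq_card: "eigenvalue_count w A = card {j \<in> I. ev j \<in> A}"
proof -
  have "{j \<in> I. ev j \<in> A} = (\<Union>t\<in>ev ` I \<inter> A. {j \<in> I. ev j = t})"
    by auto
  moreover have "card (\<Union>t\<in>ev ` I \<inter> A. {j \<in> I. ev j = t})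
      = (\<Sum>t\<in>ev ` I \<inter> A. card {j \<in> I. ev j = t})"
    by (rule card_UN_disjoint) (auto simp: finite_index)
  ultimately show ?thesis
    by (simp add: eigenvalue_count_def eigenvalues_eq dim_eigenspace)
qed

end

section \<open>Uniqueness sets bound dimensions\<close>

text \<open>Restriction to \<open>S\<close> is linear and, by uniqueness, injective on the span, so
  it carries \<open>B\<close> to an independent set inside the span of the point masses on
  \<open>S\<close>.\<close>

lemma card_le_card_uniqueness_set:
  fixes B :: "(complex ^ 'v::finite) set"
  assumes "vec.independent B" "uniqueness_set S (vec.span B)"
  shows "card B \<le> card S"
proof -
  \<comment> \<open>Restriction to \<open>S\<close> is followed by extension by zero, so that it
    stays inside \<open>complex ^ 'v\<close>.\<close>
  define R :: "complex ^ 'v \<Rightarrow> complex ^ 'v" where "R f = (\<chi> v. if v \<in> S then f $ v else 0)" for f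
  have lin: "Vector_Spaces.linear (*s) (*s) R"
    by unfold_locales (auto simp: R_def vec_eq_iff algebra_simps)
  have inj: "inj_on R (vec.span B)"
  proof (rule inj_onI)
    fix f g assume fg: "f \<in> vec.span B" "g \<in> vec.span B" "R f = R g"
    have "f $ s = g $ s" if "s \<in> S" for s
      using arg_cong[OF fg(3), of "\<lambda>h. h $ s"] that by (simp add: R_def)
    then show "f = g"
      using assms(2) fg(1,2) unfolding uniqueness_set_def by blast
  qed
  have "R f = (\<Sum>v\<in>S. f $ v *s axis v 1)" for f
    by (simp add: R_def vec_eq_iff axis_def if_distrib cong: if_cong)
  then have "R f \<in> vec.span ((\<lambda>v. axis v 1) ` S)" for f
    by (simp only:) (intro vec.span_sum vec.span_scale vec.span_base imageI)
  then have "card (R ` B) \<le> card ((\<lambda>v. axis v 1 :: complex ^ 'v) ` S)"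
    using vec.linear_independent_injective_image[OF lin assms(1) inj]
    by (intro vec.independent_span_bound[THEN conjunct2]) auto
  also have "\<dots> \<le> card S"
    by (rule card_image_le) simp
  finally show ?thesis
    using inj_on_subset[OF inj vec.span_superset] by (simp add: card_image)
qed

section \<open>Eigenfunctions of the complete bipartite graph\<close>

lemma complete_bipartite_sym: "complete_bipartite S u v = complete_bipartite S v u"
  by (auto simp: complete_bipartite_def)

lemma laplacian_complete_bipartite:
  fixes S :: "'v::finite set"
  shows "laplacian (complete_bipartite S) f $ v =
    (if v \<in> S then of_nat (card (- S)) * f $ v - sum (($) f) (- S)
     else of_nat (card S) * f $ v - sum (($) f) S)"
proof -
  have "laplacian (complete_bipartite S) f $ v =
      (\<Sum>u\<in>(if v \<in> S then - S else S). f $ v - f $ u)"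
    unfolding laplacian_def complete_bipartite_def
    by (auto simp: if_distrib sum.If_cases Compl_eq cong: if_cong intro!: sum.cong)
  then show ?thesis
    by (simp add: sum_subtractf)
qed

context
  fixes S :: "'v::finite set" and f :: "complex ^ 'v" and t :: real
  assumes larger: "card (- S) < card S"
    and eigen: "laplacian (complete_bipartite S) f = of_real t *s f"
begin

lemma eigen_in: "v \<in> S \<Longrightarrow> of_real (card (- S) - t) * f $ v = sum (($) f) (- S)"
  using laplacian_complete_bipartite[of S f v] by (simp add: eigen algebra_simps)

lemma eigen_out: "v \<notin> S \<Longrightarrow> of_real (card S - t) * f $ v = sum (($) f) S"
  using laplacian_complete_bipartite[of S f v] by (simp add: eigen algebra_simps)

text \<open>Summing the pointwise equations over each part gives a 2 by 2 linear system for the two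
  part sums.\<close>

lemma eigen_sum_in: "of_real (card (- S) - t) * sum (($) f) S = of_nat (card S) * sum (($) f) (- S)"
  using eigen_in by (simp add: sum_distrib_left)

lemma eigen_sum_out:
  "of_real (card S - t) * sum (($) f) (- S) = of_nat (card (- S)) * sum (($) f) S"
  using eigen_out by (simp add: sum_distrib_left)


text \<open>With n and k the sizes of \<open>S\<close> and its complement, the system for the part
  sums has determinant (k - t)(n - t) - nk = t(t - n - k). Either \<open>t\<close> is a root of it
  or both sums vanish.\<close>

lemma eigenvalue_or_sums_zero:
  "t = 0 \<or> t = card S + card (- S) \<or> sum (($) f) S = 0 \<and> sum (($) f) (- S) = 0"
proof -
  let ?n = "of_nat (card S) :: complex" and ?k = "of_nat (card (- S)) :: complex"
  let ?A = "sum (($) f) S" and ?B = "sum (($) f) (- S)"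
  have A: "(?k - of_real t) * ?A = ?n * ?B" and B: "(?n - of_real t) * ?B = ?k * ?A"
    using eigen_sum_in eigen_sum_out by simp_all
  have "of_real t * (of_real t - (?n + ?k)) * ?A = 0" "of_real t * (of_real t - (?n + ?k)) * ?B = 0"
    using A B by algebra+
  then have "complex_of_real t = 0 \<or> complex_of_real t = of_real (card S + card (- S)) \<or> ?A = 0 \<and> ?B = 0"
    by auto
  then show ?thesis
    unfolding of_real_eq_iff of_real_eq_0_iff .
qed

text \<open>
  The factors \<open>1\<close> and \<open>- 1\<close> in the next two statements are kept explicit to match
  \<open>uniqueness_set_proportional_to_sum\<close>.
\<close>

lemma eigen_low:
  assumes "t < card S" "v \<notin> S"
  shows "of_nat (card S) * f $ v = 1 * sum (($) f) S"
  using eigenvalue_or_sums_zero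
proof (elim disjE)
  assume "t = 0"
  then show ?thesis
    using eigen_out[OF assms(2)] by simp
next
  assume "t = real (card S + card (- S))"
  then show ?thesis
    using assms(1) by simp
next
  assume zero: "sum (($) f) S = 0 \<and> sum (($) f) (- S) = 0"
  have "complex_of_real (real (card S) - t) \<noteq> 0"
    using assms(1) unfolding of_real_eq_0_iff by simp
  then have "f $ v = 0"
    using eigen_out[OF assms(2)] zero by (metis mult_eq_0_iff)
  then show ?thesis
    using zero by simp
qed

lemma eigen_high:
  assumes "card S \<le> t" "v \<in> S"
  shows "of_nat (card S) * f $ v = - 1 * sum (($) f) (- S)"
  using eigenvalue_or_sums_zero
proof (elim disjE)
  assume "t = 0"
  then show ?thesis
    using assms(1) larger by simp
next
  \<comment> \<open>Here the factor in \<open>eigen_in\<close> is k - t = -n, which produces the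
    minus sign in the claim.\<close>
  assume "t = real (card S + card (- S))"
  then show ?thesis
    using eigen_in[OF assms(2)] by (simp add: minus_equation_iff)
next
  assume zero: "sum (($) f) S = 0 \<and> sum (($) f) (- S) = 0"
  \<comment> \<open>This is where the sizes of the parts matter: \<open>t\<close> is at least
    \<open>card S\<close>, hence different from \<open>card (- S)\<close>, the value for which
    \<open>f\<close> could be nonzero on \<open>S\<close> with vanishing sums.\<close>
  have "complex_of_real (real (card (- S)) - t) \<noteq> 0"
    using assms(1) larger unfolding of_real_eq_0_iff by simp
  then have "f $ v = 0"
    using eigen_in[OF assms(2)] zero by (metis mult_eq_0_iff)
  then show ?thesis
    using zero by simp
qed

text \<open>If both part sums vanish, a vertex at which \<open>f\<close> is nonzero forces
  \<open>t\<close> to be the size of the opposite part. The only other values are 0 and the number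
  of vertices.\<close>

lemma eigenvalue_nonneg:
  assumes "f \<noteq> 0"
  shows "0 \<le> t"
  using eigenvalue_or_sums_zero
proof (elim disjE)
  assume zero: "sum (($) f) S = 0 \<and> sum (($) f) (- S) = 0"
  obtain v where "f $ v \<noteq> 0"
    using assms by (auto simp: vec_eq_iff)
  then have "complex_of_real (real (card (if v \<in> S then - S else S)) - t) = 0"
    using eigen_in[of v] eigen_out[of v] zero by (metis mult_eq_0_iff)
  then show ?thesis
    unfolding of_real_eq_0_iff by (metis diff_eq_eq add_0 of_nat_0_le_iff)
qed simp_all

end

section \<open>Uniqueness from values proportional to a sum\<close>

lemma subspace_proportional_to_sum:
  "vec.subspace {f :: complex ^ 'v::finite. \<forall>v. v \<notin> U \<longrightarrow> a * f $ v = c * sum (($) f) U}"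
  by (auto simp: vec.subspace_def sum.distrib algebra_simps simp flip: sum_distrib_left)

text \<open>The condition is linear in \<open>f\<close>, so it passes from \<open>X\<close> to its
  span. There the values on \<open>U\<close> fix the sum over \<open>U\<close>, and with
  \<open>a \<noteq> 0\<close> the sum fixes all values outside \<open>U\<close>.\<close>

lemma uniqueness_set_proportional_to_sum:
  fixes X :: "(complex ^ 'v::finite) set"
  assumes "a \<noteq> 0" "\<And>f v. f \<in> X \<Longrightarrow> v \<notin> U \<Longrightarrow> a * f $ v = c * sum (($) f) U"
  shows "uniqueness_set U (vec.span X)"
  unfolding uniqueness_set_def
proof (intro ballI impI)
  fix f g assume f: "f \<in> vec.span X" and g: "g \<in> vec.span X" and eq: "\<forall>u\<in>U. f $ u = g $ u"
  let ?P = "{f :: complex ^ 'v. \<forall>v. v \<notin> U \<longrightarrow> a * f $ v = c * sum (($) f) U}"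
  have "vec.span X \<subseteq> ?P"
    using assms(2) by (intro vec.span_minimal subspace_proportional_to_sum) auto
  then have fg: "a * f $ v = c * sum (($) f) U" "a * g $ v = c * sum (($) g) U" if "v \<notin> U" for v
    using f g that by blast+
  have "sum (($) f) U = sum (($) g) U"
    using eq by simp
  then have "f $ v = g $ v" for v
    using fg[of v] eq assms(1) by (metis mult_left_cancel)
  then show "f = g"
    by (simp add: vec_eq_iff)
qed

lemma uniqueness_set_PW_complete_bipartite:
  fixes S :: "'v::finite set" and \<omega> :: real
  assumes "card (- S) < card S" "\<omega> < card S"
  shows "uniqueness_set S (PW (complete_bipartite S) \<omega>)"
  unfolding PW_def
proof (rule uniqueness_set_proportional_to_sum)
  show "of_nat (card S) \<noteq> (0 :: complex)"
    using assms(1) by (simp only: of_nat_eq_0_iff)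
  fix f :: "complex ^ 'v" and v
  assume "f \<in> (\<Union>t\<in>{..\<omega>}. eigenspace (complete_bipartite S) t)" "v \<notin> S"
  then obtain t :: real where "t < card S" "laplacian (complete_bipartite S) f = of_real t *s f"
    using assms(2) unfolding eigenspace_def by (metis (mono_tags) UN_E atMost_iff le_less_trans mem_Collect_eq)
  then show "of_nat (card S) * f $ v = 1 * sum (($) f) S"
    using eigen_low[OF assms(1)] \<open>v \<notin> S\<close> by blast
qed

section \<open>An eigenfunction for \<open>card S\<close> that vanishes on \<open>S\<close>\<close>

text \<open>The function vanishes on \<open>S\<close> and both its part sums are zero, so only the
  diagonal term of the Laplacian outside \<open>S\<close> survives.\<close>

lemma laplacian_axis_diff:
  fixes S :: "'v::finite set"
  assumes "a \<notin> S" "b \<notin> S"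
  shows "laplacian (complete_bipartite S) (axis a 1 - axis b 1) =
    of_nat (card S) *s (axis a 1 - axis b 1)"
proof -
  have "sum (($) (axis a 1 - axis b 1 :: complex ^ 'v)) (- S) = 0"
    using assms by (simp add: axis_def sum_subtractf)
  moreover have "sum (($) (axis a 1 - axis b 1 :: complex ^ 'v)) S = 0"
    using assms by (intro sum.neutral) (auto simp: axis_def)
  moreover have "(axis a 1 - axis b 1 :: complex ^ 'v) $ v = 0" if "v \<in> S" for v
    using assms that by (auto simp: axis_def)
  ultimately show ?thesis
    by (simp add: vec_eq_iff laplacian_complete_bipartite right_diff_distrib)
qed

text \<open>The difference of the point masses at \<open>a\<close> and \<open>b\<close> belongs to
  this space and agrees with \<open>0\<close> on \<open>S\<close>. The strict inequality
  \<open>\<omega> < card S\<close> of the uniqueness result is thus optimal.\<close>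

lemma not_uniqueness_set_PW_complete_bipartite:
  fixes S :: "'v::finite set"
  assumes "a \<notin> S" "b \<notin> S" "a \<noteq> b"
  shows "\<not> uniqueness_set S (PW (complete_bipartite S) (card S))"
proof
  let ?d = "axis a 1 - axis b 1 :: complex ^ 'v"
  assume "uniqueness_set S (PW (complete_bipartite S) (card S))"
  moreover have "?d \<in> PW (complete_bipartite S) (card S)"
    unfolding PW_def using laplacian_axis_diff[OF assms(1,2)]
    by (intro vec.span_base UN_I[of "real (card S)"]) (simp_all add: eigenspace_def)
  moreover have "0 \<in> PW (complete_bipartite S) (card S)"
    by (simp add: PW_def vec.span_zero)
  moreover have "\<forall>s\<in>S. ?d $ s = 0 $ s"
    using assms by (auto simp: axis_def)
  ultimately have "?d = 0"
    unfolding uniqueness_set_def by blast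
  then have "?d $ a = 0"
    by simp
  then show False
    using assms(3) by (simp add: axis_def)
qed

section \<open>The Poincare constant and \<open>K_const\<close>\<close>

lemma l2_inner_self: "l2_inner m f f = of_real (\<Sum>v\<in>UNIV. (cmod (f $ v))\<^sup>2 * m v)"
  by (simp add: l2_inner_def complex_norm_square[symmetric] flip: of_real_power)

lemma l2_norm_eq: "l2_norm m f = sqrt (\<Sum>v\<in>UNIV. (cmod (f $ v))\<^sup>2 * m v)"
  by (simp only: l2_norm_def l2_inner_self Re_complex_of_real)

lemma l2_norm_scale: "l2_norm m (c *s f) = cmod c * l2_norm m f"
  by (simp add: l2_norm_eq norm_mult power_mult_distrib mult.assoc real_sqrt_mult
      flip: sum_distrib_left)

text \<open>The comparison holds at every vertex: on \<open>S\<close> the left side is zero, and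
  outside \<open>S\<close> the Laplacian is exactly \<open>card S\<close> times \<open>f\<close>,
  since \<open>f\<close> has zero sum over \<open>S\<close>.\<close>

lemma l2_norm_laplacian_ge:
  assumes "\<And>v. 0 \<le> m v" "\<And>v. v \<in> S \<Longrightarrow> f $ v = 0"
  shows "card S * l2_norm m f \<le> l2_norm m (laplacian (complete_bipartite S) f)"
proof -
  have "card S * l2_norm m f = l2_norm m (of_nat (card S) *s f)"
    by (simp add: l2_norm_scale)
  also have "\<dots> \<le> l2_norm m (laplacian (complete_bipartite S) f)"
    unfolding l2_norm_eq using assms
    by (intro real_sqrt_le_mono sum_mono mult_right_mono power_mono)
      (auto simp: laplacian_complete_bipartite)
  finally show ?thesis .
qed

text \<open>The constant \<open>card S\<close> is admissible by \<open>l2_norm_laplacian_ge\<close>,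
  and the difference of two point masses in the complement attains equality, so no larger constant
  is.\<close>

lemma poincare_constant_complete_bipartite:
  fixes S :: "'v::finite set"
  assumes m: "\<And>v. 0 \<le> m v" "0 < m a"
    and ab: "a \<notin> S" "b \<notin> S" "a \<noteq> b" and S: "S \<noteq> {}"
  shows "poincare_constant m (complete_bipartite S) (- S) = card S"
  unfolding poincare_constant_def
proof (rule Greatest_equality)
  have "0 < card S"
    using S by (simp add: card_gt_0_iff)
  then show "0 < real (card S) \<and> (\<forall>\<phi>. (\<forall>v. v \<notin> - S \<longrightarrow> \<phi> $ v = 0) \<longrightarrow>
      l2_norm m \<phi> \<le> inverse (real (card S)) * l2_norm m (laplacian (complete_bipartite S) \<phi>))"
    using l2_norm_laplacian_ge[of m S] m(1) by (auto simp: field_simps)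
next
  let ?d = "axis a 1 - axis b 1 :: complex ^ 'v"
  fix L assume L: "0 < L \<and> (\<forall>\<phi>. (\<forall>v. v \<notin> - S \<longrightarrow> \<phi> $ v = 0) \<longrightarrow>
      l2_norm m \<phi> \<le> inverse L * l2_norm m (laplacian (complete_bipartite S) \<phi>))"
  have "\<forall>v. v \<notin> - S \<longrightarrow> ?d $ v = 0"
    using ab by (auto simp: axis_def)
  then have "l2_norm m ?d \<le> inverse L * l2_norm m (laplacian (complete_bipartite S) ?d)"
    using L by blast
  also have "\<dots> = inverse L * (card S * l2_norm m ?d)"
    by (simp only: laplacian_axis_diff[OF ab(1,2)] l2_norm_scale norm_of_nat)
  finally have "l2_norm m ?d \<le> inverse L * (card S * l2_norm m ?d)" .
  \<comment> \<open>Positivity of the measure at \<open>a\<close> alone makes this norm positive, so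
    that it can be cancelled.\<close>
  moreover have "0 < l2_norm m ?d"
    unfolding l2_norm_eq real_sqrt_gt_0_iff
    using m ab by (intro sum_pos2[of _ a]) (auto simp: axis_def)
  ultimately show "L \<le> real (card S)"
    using L by (simp add: field_simps)
qed

text \<open>The infimum is that of a constant function, over an index set that must be
  nonempty.\<close>

lemma K_const_complete_bipartite:
  assumes "- S \<noteq> {}"
  shows "K_const (complete_bipartite S) S = card S"
proof -
  have "(\<Sum>s\<in>S. complete_bipartite S s v) = card S" if "v \<in> - S" for v
    using that by (simp add: complete_bipartite_def)
  then show ?thesis
    using assms by (simp add: K_const_def)
qed

lemma vertex_degree_complete_bipartite:
  fixes S :: "'v::finite set"
  shows "vertex_degree (complete_bipartite S) v = card (if v \<in> S then - S else S)"
  by (simp add: vertex_degree_def complete_bipartite_def sum.If_cases Compl_eq)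

section \<open>Eigenvalue counts on both sides of \<open>N\<close>, and sharpness\<close>

text \<open>The guard \<open>2 \<le> M\<close> is essential. For \<open>M = 1\<close> the functions
  vanishing on \<open>S\<close> are multiples of one point mass, the Poincare constant is
  \<open>sqrt (N^2 + 1)\<close> for the degree measure and \<open>sqrt (N^2 + N)\<close> for the
  counting measure, and \<open>ev N = N + 1\<close>. Sharpness means equality in each estimate, and
  failure of uniqueness at \<open>\<omega> = \<Lambda>\<close>.\<close>

theorem mainTheorem3:
  fixes S :: "'v::finite set"
    and N M :: nat
    and w :: "'v \<Rightarrow> 'v \<Rightarrow> real"
    and m :: "'v \<Rightarrow> real"
    and ev :: "nat \<Rightarrow> real"
    and e :: "nat \<Rightarrow> complex ^ 'v"
  assumes "card S = N" and "card (- S) = M" and "1 \<le> M" and "M < N"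
    and "w = complete_bipartite S"
    and "m = vertex_degree w \<or> m = (\<lambda>_. 1)"
    and "mono_on {..<N + M} ev"
    and "orthonormal_family (\<lambda>_. 1) {..<N + M} e"
    and "\<And>j. j < N + M \<Longrightarrow> laplacian w (e j) = of_real (ev j) *s e j"
  shows
    "(2 \<le> M \<longrightarrow> poincare_constant m w (- S) = K_const w S) \<and>
     K_const w S = real (card S) \<and> card S = N \<and>
     uniqueness_set S (vec.span (e ` {..<N})) \<and>
     eigenvalue_count w {0..<real N} = N \<and>
     eigenvalue_count w {real N..ev (N + M - 1)} = M \<and>
     (2 \<le> M \<longrightarrow> ev N = real N) \<and>
     (2 \<le> M \<longrightarrow>
       (let \<Lambda> = poincare_constant m w (- S) in
         \<Lambda> = K_const w S \<and>
         (\<forall>\<omega> < \<Lambda>. uniqueness_set S (PW w \<omega>)) \<and> \<not> uniqueness_set S (PW w \<Lambda>) \<and>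
         eigenvalue_count w {0..<\<Lambda>} = card S \<and>
         eigenvalue_count w {\<Lambda>..ev (CARD('v) - 1)} = card (- S) \<and>
         ev (card S) = \<Lambda>))"
proof -
  note sizes = assms(1-4)
  have nonempty: "S \<noteq> {}" "- S \<noteq> {}"
    using sizes by (metis card.empty not_less0, metis card.empty not_one_le_zero)
  \<comment> \<open>Both choices of the measure are handled at once through these two sign
    properties.\<close>
  have m_nonneg: "0 \<le> m v" and m_pos: "v \<notin> S \<Longrightarrow> 0 < m v" for v
    using assms(6) sizes by (auto simp: assms(5) vertex_degree_complete_bipartite)
  have card_V: "CARD('v) = N + M"
    using sizes card_Un_disjoint[of S "- S"] by (simp add: Compl_partition)
  have larger: "card (- S) < card S"
    using sizes by simp
  interpret orthonormal_eigenbasis w "{..<N + M}" e ev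
    using assms(8,9) by unfold_locales (auto simp: assms(5) complete_bipartite_sym card_V)
  have eigen: "laplacian (complete_bipartite S) (e j) = of_real (ev j) *s e j" if "j < N + M" for j
    using assms(9)[OF that] by (simp only: assms(5))
  have ev_nonneg: "0 \<le> ev j" if "j < N + M" for j
  proof (rule eigenvalue_nonneg[OF larger eigen[OF that]])
    show "e j \<noteq> 0"
      using orthonormal_nonzero[OF orthonormal] that by simp
  qed
  define low where "low = {j \<in> {..<N + M}. ev j < N}"
  define high where "high = {j \<in> {..<N + M}. N \<le> ev j}"
  have N_nonzero: "of_nat N \<noteq> (0 :: complex)"
    using sizes by simp
  have low_unique: "uniqueness_set S (vec.span (e ` low))"
    using eigen_low[OF larger eigen] sizes
    by (intro uniqueness_set_proportional_to_sum[OF N_nonzero, where c = 1]) (auto simp: low_def)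
  have high_unique: "uniqueness_set (- S) (vec.span (e ` high))"
    using eigen_high[OF larger eigen] sizes
    by (intro uniqueness_set_proportional_to_sum[OF N_nonzero, where c = "- 1"]) (auto simp: high_def)
  have sub: "low \<subseteq> {..<N + M}" "high \<subseteq> {..<N + M}"
    by (auto simp: low_def high_def)
  note inj = sub[THEN inj_on_subset[OF orthonormal_inj_on[OF orthonormal]]]
  have "card low \<le> N"
    using card_le_card_uniqueness_set[OF independent_subfamily[OF sub(1)] low_unique] sizes
    by (simp add: card_image[OF inj(1)])
  moreover have "card high \<le> M"
    using card_le_card_uniqueness_set[OF independent_subfamily[OF sub(2)] high_unique] sizes
    by (simp add: card_image[OF inj(2)])
  moreover have "card low + card high = N + M"
  proof -
    have "low \<union> high = {..<N + M}" "low \<inter> high = {}"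
      by (auto simp: low_def high_def)
    then show ?thesis
      using card_Un_disjoint[of low high] by (simp add: low_def high_def)
  qed
  \<comment> \<open>Two upper bounds whose sum is attained are both equalities.\<close>
  ultimately have card_low: "card low = N" and card_high: "card high = M"
    by simp_all
  have ev_mono: "ev i \<le> ev j" if "i \<le> j" "j < N + M" for i j
    using mono_onD[OF assms(7)] that by simp
  \<comment> \<open>Monotonicity makes \<open>low\<close> downward closed. If \<open>j\<close> is in
    \<open>low\<close>, so are the \<open>j + 1\<close> indices up to \<open>j\<close>, whence
    \<open>j + 1 \<le> N\<close>.\<close>
  have low_eq: "low = {..<N}"
  proof -
    have "j < N" if "j \<in> low" for j
    proof -
      have "{..j} \<subseteq> low"
        using that ev_mono[of _ j] by (force simp: low_def)
      then have "card {..j} \<le> card low"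
        by (rule card_mono[rotated]) (simp add: low_def)
      then show ?thesis
        by (simp add: card_low)
    qed
    then show ?thesis
      using card_low by (intro card_subset_eq) auto
  qed
  \<comment> \<open>Nonnegativity of the eigenvalues makes the left end of the interval harmless;
    below, the right end is the largest eigenvalue.\<close>
  have "{j \<in> {..<N + M}. ev j \<in> {0..<real N}} = low"
    using ev_nonneg by (auto simp: low_def)
  then have count_low: "eigenvalue_count w {0..<real N} = N"
    by (simp only: eigenvalue_count_eq_card card_low)
  have "ev j \<le> ev (N + M - 1)" if "j < N + M" for j
    using that by (intro ev_mono) auto
  then have "{j \<in> {..<N + M}. ev j \<in> {real N..ev (N + M - 1)}} = high"
    by (auto simp: high_def)
  then have count_high: "eigenvalue_count w {real N..ev (N + M - 1)} = M"
    by (simp only: eigenvalue_count_eq_card card_high)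
  have K: "K_const w S = N"
    using K_const_complete_bipartite[OF nonempty(2)] sizes(1) by (simp add: assms(5))
  have sharp: "poincare_constant m w (- S) = N \<and> \<not> uniqueness_set S (PW w N) \<and> ev N = N" if "2 \<le> M"
  proof -
    have "\<not> card (- S) \<le> Suc 0"
      using that sizes(2) by simp
    then obtain a b where ab: "a \<notin> S" "b \<notin> S" "a \<noteq> b"
      by (auto simp: card_le_Suc0_iff_eq)
    have "poincare_constant m w (- S) = N"
      using poincare_constant_complete_bipartite[OF m_nonneg m_pos ab nonempty(1)] ab(1) sizes(1)
      by (simp add: assms(5))
    moreover have "\<not> uniqueness_set S (PW w N)"
      using not_uniqueness_set_PW_complete_bipartite[OF ab] sizes by (simp add: assms(5))
    \<comment> \<open>The point-mass difference shows that \<open>N\<close> is some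
      \<open>ev j\<close>. Such a \<open>j\<close> is not in \<open>low\<close>, so
      \<open>N \<le> j\<close>, and monotonicity gives \<open>ev N \<le> N\<close>. Conversely, the
      index \<open>N\<close> is itself outside \<open>low\<close>.\<close>
    moreover have "ev N = N"
    proof (rule antisym)
      have "(axis a 1 - axis b 1 :: complex ^ 'v) $ a \<noteq> 0 $ a"
        using ab(3) by (simp add: axis_def)
      then have "(axis a 1 - axis b 1 :: complex ^ 'v) \<noteq> 0"
        by metis
      then have "real N \<in> eigenvalues w"
        using laplacian_axis_diff[OF ab(1,2)] sizes(1)
        by (auto simp: eigenvalues_def assms(5) intro!: exI[of _ "axis a 1 - axis b 1"])
      then obtain j where j: "j < N + M" "ev j = N"
        by (auto simp: eigenvalues_eq)
      then have "j \<notin> low"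
        by (simp add: low_def)
      then show "ev N \<le> N"
        using ev_mono[of N j] j by (simp add: low_eq)
      have "N \<notin> low"
        by (simp add: low_eq)
      then show "N \<le> ev N"
        using sizes by (simp add: low_def)
    qed
    ultimately show ?thesis
      by blast
  qed
  have "uniqueness_set S (PW w \<omega>)" if "\<omega> < N" for \<omega> :: real
    using uniqueness_set_PW_complete_bipartite[OF larger] that sizes by (simp add: assms(5))
  then show ?thesis
    using sharp K count_low count_high low_unique sizes
    by (simp add: Let_def low_eq card_V)
qed

end
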